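(* Let $G$ be a simple graph and $r\ge 0$ an integer. The following are equivalent: (1) $G$ is $r$-locally acyclic; (2) $G$ has girth greater than $r$ (i.e., $G$ has no cycle of length at most $r$); (3) the $r$-local cover $G_r$ of $G$ is acyclic (i.e., a forest).
   Context: $B_G(v,r/2)$ is the subgraph consisting of vertices at distance at most $r/2$ from $v$ and edges whose endpoints' distances to $v$ sum to strictly less than $r$. $G$ is $r$-locally acyclic if $B_G(v,r/2)$ is acyclic for every vertex $v$. A covering of $G$ is a surjective homomorphism $p\colon\hat G\to G$ restricting, at each vertex $\hat v$, to a bijection between the edges at $\hat v$ and the edges at $p(\hat v)$, such that $p^{-1}(C)$ is connected for every component $C$ of $G$. It is $r/2$-ball-preserving if it restricts to an isomorphism $B_{\hat G}(\hat v,r/2)\to B_G(p(\hat v),r/2)$ for every $\hat v$. The $r$-local covering $p_r\colon G_r\to G$ is the universal $r/2$-ball-preserving covering (every $r/2$-ball-preserving covering $p$ satisfies $p_r=p\circ q$ for some covering $q$), and $G_r$ is the $r$-local cover. *)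

theory Defs
  imports Main "HOL-Library.Extended_Nat"
begin

section \<open>Simple graphs\<close>

text \<open>Graphs may be infinite and need not be connected.\<close>

datatype 'a graph = Graph (verts: "'a set") (edges: "'a set set")

definition simple_graph :: "'a graph \<Rightarrow> bool" where
  "simple_graph G \<longleftrightarrow> (\<forall>e\<in>edges G. e \<subseteq> verts G \<and> card e = 2)"

definition edges_at :: "'a graph \<Rightarrow> 'a \<Rightarrow> 'a set set" where
  "edges_at G v = {e \<in> edges G. v \<in> e}"

definition walk :: "'a graph \<Rightarrow> 'a list \<Rightarrow> bool" where
  "walk G vs \<longleftrightarrow> vs \<noteq> [] \<and> set vs \<subseteq> verts G \<and> successively (\<lambda>x y. {x, y} \<in> edges G) vs"

definition walk_betw :: "'a graph \<Rightarrow> 'a \<Rightarrow> 'a list \<Rightarrow> 'a \<Rightarrow> bool" where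
  "walk_betw G u vs v \<longleftrightarrow> walk G vs \<and> hd vs = u \<and> last vs = v"

definition connected_graph :: "'a graph \<Rightarrow> bool" where
  "connected_graph G \<longleftrightarrow> (\<forall>u\<in>verts G. \<forall>v\<in>verts G. \<exists>vs. walk_betw G u vs v)"

definition induced_subgraph :: "'a graph \<Rightarrow> 'a set \<Rightarrow> 'a graph" where
  "induced_subgraph G U = Graph (verts G \<inter> U) {e \<in> edges G. e \<subseteq> U}"

definition components :: "'a graph \<Rightarrow> 'a graph set" where
  "components G = (\<lambda>v. induced_subgraph G {u. \<exists>vs. walk_betw G v vs u}) ` verts G"

text \<open>The distance is \<open>\<infinity>\<close> between vertices of different components.\<close>

definition gdist :: "'a graph \<Rightarrow> 'a \<Rightarrow> 'a \<Rightarrow> enat" where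
  "gdist G u v = (INF vs\<in>{vs. walk_betw G u vs v}. enat (length vs - 1))"

text \<open>A cycle of length \<open>n\<close> is given by the list of its \<open>n\<close> vertices in cyclic order.\<close>

definition is_cycle :: "'a graph \<Rightarrow> 'a list \<Rightarrow> bool" where
  "is_cycle G c \<longleftrightarrow> 3 \<le> length c \<and> distinct c \<and> walk G c \<and> {last c, hd c} \<in> edges G"

definition acyclic_graph :: "'a graph \<Rightarrow> bool" where
  "acyclic_graph G \<longleftrightarrow> (\<nexists>c. is_cycle G c)"

text \<open>The girth of an acyclic graph is \<open>\<infinity>\<close>.\<close>

definition girth :: "'a graph \<Rightarrow> enat" where
  "girth G = (INF c\<in>{c. is_cycle G c}. enat (length c))"

definition graph_iso :: "'a graph \<Rightarrow> 'b graph \<Rightarrow> ('a \<Rightarrow> 'b) \<Rightarrow> bool" where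
  "graph_iso G H f \<longleftrightarrow> bij_betw f (verts G) (verts H) \<and>
     (\<forall>x\<in>verts G. \<forall>y\<in>verts G. {x, y} \<in> edges G \<longleftrightarrow> {f x, f y} \<in> edges H)"


section \<open>Balls and local acyclicity\<close>

text \<open>\<open>ball_half G v r\<close> is the ball of radius \<open>r/2\<close> around \<open>v\<close>; the bound on the
  distance is doubled to avoid fractions.\<close>

definition ball_half :: "'a graph \<Rightarrow> 'a \<Rightarrow> nat \<Rightarrow> 'a graph" where
  "ball_half G v r = Graph {u \<in> verts G. 2 * gdist G v u \<le> enat r}
                           {e \<in> edges G. (\<Sum>u\<in>e. gdist G v u) < enat r}"

definition locally_acyclic :: "nat \<Rightarrow> 'a graph \<Rightarrow> bool" where
  "locally_acyclic r G \<longleftrightarrow> (\<forall>v\<in>verts G. acyclic_graph (ball_half G v r))"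


section \<open>Coverings\<close>

definition preimage_subgraph :: "('b \<Rightarrow> 'a) \<Rightarrow> 'b graph \<Rightarrow> 'a graph \<Rightarrow> 'b graph" where
  "preimage_subgraph p H C = Graph {v \<in> verts H. p v \<in> verts C} {e \<in> edges H. p ` e \<in> edges C}"

definition surj_hom :: "'b graph \<Rightarrow> 'a graph \<Rightarrow> ('b \<Rightarrow> 'a) \<Rightarrow> bool" where
  "surj_hom H G p \<longleftrightarrow> p ` verts H = verts G \<and> (\<lambda>e. p ` e) ` edges H = edges G"

definition covering :: "'b graph \<Rightarrow> 'a graph \<Rightarrow> ('b \<Rightarrow> 'a) \<Rightarrow> bool" where
  "covering H G p \<longleftrightarrow> simple_graph H \<and> simple_graph G \<and> surj_hom H G p \<and>
     (\<forall>v\<in>verts H. bij_betw (\<lambda>e. p ` e) (edges_at H v) (edges_at G (p v))) \<and>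
     (\<forall>C\<in>components G. connected_graph (preimage_subgraph p H C))"

definition ball_preserving :: "nat \<Rightarrow> 'b graph \<Rightarrow> 'a graph \<Rightarrow> ('b \<Rightarrow> 'a) \<Rightarrow> bool" where
  "ball_preserving r H G p \<longleftrightarrow>
     (\<forall>v\<in>verts H. graph_iso (ball_half H v r) (ball_half G (p v) r) p)"

text \<open>\<open>local_covering r Gr G pr\<close>: the map \<open>pr\<close> is the \<open>r\<close>-local covering of \<open>G\<close>, and \<open>Gr\<close> its
  \<open>r\<close>-local cover, both of which are determined up to isomorphism. HOL cannot quantify over the
  type of the vertices of the competing coverings \<open>H\<close>, so these are taken on lists over the
  vertex type of \<open>G\<close>. This is no restriction, since a vertex of a covering is determined by the
  projection of a walk to it: see \<open>local_covering_universal\<close> below, where the vertex type of \<open>H\<close>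
  is arbitrary, and \<open>local_covering_exists\<close>.\<close>

definition local_covering :: "nat \<Rightarrow> 'b graph \<Rightarrow> 'a graph \<Rightarrow> ('b \<Rightarrow> 'a) \<Rightarrow> bool" where
  "local_covering r Gr G pr \<longleftrightarrow> covering Gr G pr \<and> ball_preserving r Gr G pr \<and>
     (\<forall>(H :: 'a list graph) p. covering H G p \<and> ball_preserving r H G p \<longrightarrow>
        (\<exists>q. covering Gr H q \<and> (\<forall>x\<in>verts Gr. pr x = p (q x))))"


section \<open>Universality and existence of the local covering\<close>

definition adj :: "'a graph \<Rightarrow> 'a \<Rightarrow> 'a \<Rightarrow> bool" where
  "adj G x y \<longleftrightarrow> {x, y} \<in> edges G"

lemma adj_verts: "simple_graph G \<Longrightarrow> adj G x y \<Longrightarrow> x \<in> verts G \<and> y \<in> verts G \<and> x \<noteq> y"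
  unfolding simple_graph_def adj_def by fastforce

lemma adj_sym: "adj G x y \<Longrightarrow> adj G y x"
  by (simp add: adj_def insert_commute)

lemma adj_rtranclp_sym: "(adj G)\<^sup>*\<^sup>* x y \<Longrightarrow> (adj G)\<^sup>*\<^sup>* y x"
  by (induction rule: rtranclp_induct) (auto intro: converse_rtranclp_into_rtranclp adj_sym)

lemma edge_obtain:
  assumes "simple_graph G" "e \<in> edges G" "x \<in> e"
  obtains y where "e = {x, y}" "adj G x y"
proof -
  have "card e = 2" using assms by (auto simp: simple_graph_def)
  then obtain a b where "e = {a, b}" by (auto simp: card_2_iff)
  then have "\<exists>y. e = {x, y}" using assms(3) by auto
  then show thesis using that assms(2) by (auto simp: adj_def)
qed

lemma adj_pow_verts: "simple_graph G \<Longrightarrow> u \<in> verts G \<Longrightarrow> (adj G ^^ n) u v \<Longrightarrow> v \<in> verts G"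
  by (cases n) (auto dest: adj_verts)

lemma adj_rtranclp_verts: "simple_graph G \<Longrightarrow> u \<in> verts G \<Longrightarrow> (adj G)\<^sup>*\<^sup>* u v \<Longrightarrow> v \<in> verts G"
  by (metis adj_pow_verts rtranclp_imp_relpowp)

lemma walk_Cons: "walk G (x # xs) \<longleftrightarrow> x \<in> verts G \<and> (xs = [] \<or> adj G x (hd xs) \<and> walk G xs)"
  by (auto simp: walk_def adj_def successively_Cons)

lemma walk_pow: "walk G vs \<Longrightarrow> (adj G ^^ (length vs - 1)) (hd vs) (last vs)"
proof (induction vs)
  case (Cons x xs)
  show ?case
  proof (cases xs)
    case (Cons y ys)
    then show ?thesis using Cons.IH Cons.prems
      by (auto simp: walk_Cons simp del: relpowp.simps intro: relpowp_Suc_I2)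
  qed simp
qed (simp add: walk_def)

lemma pow_walk:
  assumes "simple_graph G"
  shows "u \<in> verts G \<Longrightarrow> (adj G ^^ n) u v \<Longrightarrow> \<exists>vs. walk_betw G u vs v \<and> length vs = Suc n"
proof (induction n arbitrary: u)
  case 0
  then show ?case by (intro exI[of _ "[u]"]) (auto simp: walk_betw_def walk_def)
next
  case (Suc n)
  then obtain w where w: "adj G u w" "(adj G ^^ n) w v"
    by (metis relpowp_Suc_D2)
  then obtain vs where "walk_betw G w vs v" "length vs = Suc n"
    using Suc.IH adj_verts[OF assms w(1)] by blast
  then show ?case using w(1) Suc.prems(1)
    by (intro exI[of _ "u # vs"]) (auto simp: walk_betw_def walk_Cons)
qed

lemma walk_betw_iff:
  assumes "simple_graph G"
  shows "(\<exists>vs. walk_betw G u vs v) \<longleftrightarrow> u \<in> verts G \<and> (adj G)\<^sup>*\<^sup>* u v"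
proof
  assume "\<exists>vs. walk_betw G u vs v"
  then show "u \<in> verts G \<and> (adj G)\<^sup>*\<^sup>* u v"
    unfolding walk_betw_def using walk_pow
    by (metis hd_in_set relpowp_imp_rtranclp subset_iff walk_def)
next
  assume "u \<in> verts G \<and> (adj G)\<^sup>*\<^sup>* u v"
  then show "\<exists>vs. walk_betw G u vs v"
    using pow_walk[OF assms] by (metis rtranclp_imp_relpowp)
qed

lemma gdist_le:
  assumes "simple_graph G" "u \<in> verts G" "(adj G ^^ n) u v"
  shows "gdist G u v \<le> enat n"
proof -
  obtain vs where "walk_betw G u vs v" "length vs = Suc n" using pow_walk[OF assms] by blast
  then show ?thesis unfolding gdist_def by (metis (mono_tags) INF_lower diff_Suc_1 mem_Collect_eq)
qed

lemma gdist_pow: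
  assumes "gdist G u v = enat n"
  shows "(adj G ^^ n) u v"
proof -
  let ?S = "(\<lambda>vs. enat (length vs - 1)) ` {vs. walk_betw G u vs v}"
  have "?S \<noteq> {}" using assms unfolding gdist_def by (metis Inf_enat_def enat.simps(3))
  then have "Inf ?S \<in> ?S" by (simp add: Inf_enat_def LeastI_ex ex_in_conv del: image_is_empty)
      (metis (mono_tags, lifting) LeastI_ex ex_in_conv)
  then obtain vs where "walk_betw G u vs v" "length vs - 1 = n"
    using assms unfolding gdist_def by auto
  then show ?thesis using walk_pow by (auto simp: walk_betw_def)
qed

lemma covering_iff:
  "covering H G p \<longleftrightarrow> simple_graph H \<and> simple_graph G \<and> p ` verts H = verts G \<and>
     (\<forall>x y. adj H x y \<longrightarrow> adj G (p x) (p y)) \<and>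
     (\<forall>x\<in>verts H. \<forall>b. adj G (p x) b \<longrightarrow> (\<exists>!y. adj H x y \<and> p y = b)) \<and>
     (\<forall>x\<in>verts H. \<forall>y\<in>verts H. (adj G)\<^sup>*\<^sup>* (p x) (p y) \<longrightarrow> (adj H)\<^sup>*\<^sup>* x y)"
  (is "_ \<longleftrightarrow> ?R")
proof (cases "simple_graph H \<and> simple_graph G \<and> p ` verts H = verts G \<and>
     (\<forall>x y. adj H x y \<longrightarrow> adj G (p x) (p y))")
  case False
  have "adj G (p x) (p y)" if "covering H G p" "adj H x y" for x y
  proof -
    have "p ` {x, y} \<in> edges G" using that unfolding covering_def surj_hom_def adj_def by blast
    then show ?thesis by (simp add: adj_def)
  qed
  then show ?thesis using False by (auto simp: covering_def surj_hom_def)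
next
  case True
  then have sH: "simple_graph H" and sG: "simple_graph G" and surj: "p ` verts H = verts G"
    and hom: "\<And>x y. adj H x y \<Longrightarrow> adj G (p x) (p y)" by auto
  have local: "bij_betw (\<lambda>e. p ` e) (edges_at H x) (edges_at G (p x)) \<longleftrightarrow>
     (\<forall>b. adj G (p x) b \<longrightarrow> (\<exists>!y. adj H x y \<and> p y = b))" (is "?A \<longleftrightarrow> ?B") if x: "x \<in> verts H" for x
  proof
    assume A: ?A
    show ?B
    proof (intro allI impI ex_ex1I)
      fix b assume b: "adj G (p x) b"
      then have "{p x, b} \<in> edges_at G (p x)" by (auto simp: edges_at_def adj_def)
      then obtain e where e: "e \<in> edges_at H x" "p ` e = {p x, b}"
        using A by (metis bij_betw_imp_surj_on imageE)
      then obtain y where y: "e = {x, y}" "adj H x y"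
        using edge_obtain[OF sH, of e x] by (auto simp: edges_at_def)
      then have "p y = b" using e(2) adj_verts[OF sG b] by (auto simp: doubleton_eq_iff)
      then show "\<exists>y. adj H x y \<and> p y = b" using y by blast
    next
      fix b y y' assume *: "adj H x y \<and> p y = b" "adj H x y' \<and> p y' = b"
      then have "{x, y} \<in> edges_at H x" "{x, y'} \<in> edges_at H x" "p ` {x, y} = p ` {x, y'}"
        by (auto simp: edges_at_def adj_def)
      then have "{x, y} = {x, y'}" using A by (meson bij_betw_def inj_onD)
      then show "y = y'" by (auto simp: doubleton_eq_iff)
    qed
  next
    assume B: ?B
    have "inj_on (\<lambda>e. p ` e) (edges_at H x)"
    proof (rule inj_onI)
      fix e e' assume *: "e \<in> edges_at H x" "e' \<in> edges_at H x" "p ` e = p ` e'"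
      obtain y where y: "e = {x, y}" "adj H x y"
        using edge_obtain[OF sH, of e x] *(1) by (auto simp: edges_at_def)
      obtain y' where y': "e' = {x, y'}" "adj H x y'"
        using edge_obtain[OF sH, of e' x] *(2) by (auto simp: edges_at_def)
      have "p y = p y'" using *(3) y y' by (auto simp: doubleton_eq_iff)
      then show "e = e'" using B hom y y' by metis
    qed
    moreover have "(\<lambda>e. p ` e) ` edges_at H x = edges_at G (p x)"
    proof (intro equalityI subsetI)
      fix e assume "e \<in> (\<lambda>e. p ` e) ` edges_at H x"
      then obtain e' where e': "e' \<in> edges_at H x" "e = p ` e'" by blast
      then obtain y where y: "e' = {x, y}" "adj H x y"
        using edge_obtain[OF sH, of e' x] by (auto simp: edges_at_def)
      then show "e \<in> edges_at G (p x)" using hom[OF y(2)] e' by (auto simp: edges_at_def adj_def)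
    next
      fix e assume e: "e \<in> edges_at G (p x)"
      then obtain b where b: "e = {p x, b}" "adj G (p x) b"
        using edge_obtain[OF sG, of e "p x"] by (auto simp: edges_at_def)
      then obtain y where "adj H x y" "p y = b" using B by blast
      then have "{x, y} \<in> edges_at H x" "p ` {x, y} = e" using b by (auto simp: edges_at_def adj_def)
      then show "e \<in> (\<lambda>e. p ` e) ` edges_at H x" by blast
    qed
    ultimately show ?A by (simp add: bij_betw_def)
  qed
  have esurj: "(\<lambda>e. p ` e) ` edges H = edges G"
    if B: "\<forall>x\<in>verts H. bij_betw (\<lambda>e. p ` e) (edges_at H x) (edges_at G (p x))"
  proof (intro equalityI subsetI)
    fix e assume "e \<in> (\<lambda>e. p ` e) ` edges H"
    then obtain e' where e': "e' \<in> edges H" "e = p ` e'" by blast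
    then have "card e' = 2" using sH by (auto simp: simple_graph_def)
    then obtain x y where "e' = {x, y}" by (auto simp: card_2_iff)
    then show "e \<in> edges G" using hom[of x y] e' by (auto simp: adj_def)
  next
    fix e assume e: "e \<in> edges G"
    then have "card e = 2" "e \<subseteq> verts G" using sG by (auto simp: simple_graph_def)
    then obtain a where "a \<in> e" "a \<in> verts G" by (auto simp: card_2_iff)
    then obtain x where "x \<in> verts H" "p x \<in> e" using surj by (metis imageE)
    then have "e \<in> (\<lambda>e. p ` e) ` edges_at H x"
      using B e by (simp add: bij_betw_def edges_at_def)
    then show "e \<in> (\<lambda>e. p ` e) ` edges H" by (auto simp: edges_at_def)
  qed
  have conn: "(\<forall>C\<in>components G. connected_graph (preimage_subgraph p H C)) \<longleftrightarrow>
     (\<forall>x\<in>verts H. \<forall>y\<in>verts H. (adj G)\<^sup>*\<^sup>* (p x) (p y) \<longrightarrow> (adj H)\<^sup>*\<^sup>* x y)"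
    (is "?A \<longleftrightarrow> ?B")
  proof -
    define C where "C v = induced_subgraph G {u. \<exists>vs. walk_betw G v vs u}" for v
    have vC: "verts (C v) = {u. (adj G)\<^sup>*\<^sup>* v u}" if "v \<in> verts G" for v
      using that adj_rtranclp_verts[OF sG]
      by (auto simp: C_def induced_subgraph_def walk_betw_iff[OF sG])
    have aC: "adj (C v) x y \<longleftrightarrow> adj G x y \<and> (adj G)\<^sup>*\<^sup>* v x \<and> (adj G)\<^sup>*\<^sup>* v y" if "v \<in> verts G" for v x y
      using that
      by (auto simp: C_def induced_subgraph_def walk_betw_iff[OF sG] adj_def)
    let ?P = "\<lambda>v. preimage_subgraph p H (C v)"
    have sP: "simple_graph (?P v)" if v: "v \<in> verts G" for v
      unfolding simple_graph_def preimage_subgraph_def graph.sel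
    proof
      fix e assume e: "e \<in> {e \<in> edges H. p ` e \<in> edges (C v)}"
      then have "card e = 2" "e \<subseteq> verts H" "p ` e \<in> edges (C v)"
        using sH by (auto simp: simple_graph_def)
      moreover from this have "p ` e \<subseteq> verts (C v)"
        using sG unfolding C_def induced_subgraph_def simple_graph_def graph.sel by simp
      ultimately show "e \<subseteq> {u \<in> verts H. p u \<in> verts (C v)} \<and> card e = 2" by auto
    qed
    have aP: "adj (?P v) x y \<longleftrightarrow> adj H x y \<and> (adj G)\<^sup>*\<^sup>* v (p x)" if v: "v \<in> verts G" for v x y
    proof -
      have "adj (?P v) x y \<longleftrightarrow> adj H x y \<and> adj (C v) (p x) (p y)"
        by (auto simp: adj_def preimage_subgraph_def)
      then show ?thesis using aC[OF v] hom by (metis rtranclp.rtrancl_into_rtrancl)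
    qed
    have reach: "(adj (?P v))\<^sup>*\<^sup>* x y \<longleftrightarrow> (adj H)\<^sup>*\<^sup>* x y"
      if v: "v \<in> verts G" and x: "(adj G)\<^sup>*\<^sup>* v (p x)" for v x y
    proof
      show "(adj H)\<^sup>*\<^sup>* x y" if "(adj (?P v))\<^sup>*\<^sup>* x y"
        using that by (rule rtranclp_mono[THEN predicate2D, rotated]) (auto simp: aP[OF v])
      show "(adj (?P v))\<^sup>*\<^sup>* x y" if "(adj H)\<^sup>*\<^sup>* x y"
      proof -
        have "(adj (?P v))\<^sup>*\<^sup>* x y \<and> (adj G)\<^sup>*\<^sup>* v (p y)" using that
        proof (induction rule: rtranclp_induct)
          case (step y z)
          then show ?case using aP[OF v, of y z] hom by (meson rtranclp.rtrancl_into_rtrancl)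
        qed (use x in auto)
        then show ?thesis by blast
      qed
    qed
    have "?A \<longleftrightarrow> (\<forall>v\<in>verts G. connected_graph (?P v))"
      by (auto simp: components_def C_def)
    also have "\<dots> \<longleftrightarrow> (\<forall>v\<in>verts G. \<forall>x\<in>verts H. \<forall>y\<in>verts H.
        (adj G)\<^sup>*\<^sup>* v (p x) \<longrightarrow> (adj G)\<^sup>*\<^sup>* v (p y) \<longrightarrow> (adj H)\<^sup>*\<^sup>* x y)"
    proof (rule ball_cong[OF refl])
      fix v assume v: "v \<in> verts G"
      have vP: "x \<in> verts (?P v) \<longleftrightarrow> x \<in> verts H \<and> (adj G)\<^sup>*\<^sup>* v (p x)" for x
        using vC[OF v] by (auto simp: preimage_subgraph_def)
      show "connected_graph (?P v) \<longleftrightarrow> (\<forall>x\<in>verts H. \<forall>y\<in>verts H.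
        (adj G)\<^sup>*\<^sup>* v (p x) \<longrightarrow> (adj G)\<^sup>*\<^sup>* v (p y) \<longrightarrow> (adj H)\<^sup>*\<^sup>* x y)"
        unfolding connected_graph_def walk_betw_iff[OF sP[OF v]] Ball_def vP
        using reach[OF v] by blast
    qed
    also have "\<dots> \<longleftrightarrow> ?B"
    proof
      assume L: "\<forall>v\<in>verts G. \<forall>x\<in>verts H. \<forall>y\<in>verts H.
        (adj G)\<^sup>*\<^sup>* v (p x) \<longrightarrow> (adj G)\<^sup>*\<^sup>* v (p y) \<longrightarrow> (adj H)\<^sup>*\<^sup>* x y"
      show ?B using L surj by (metis imageI rtranclp.rtrancl_refl)
    next
      assume ?B
      then show "\<forall>v\<in>verts G. \<forall>x\<in>verts H. \<forall>y\<in>verts H.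
        (adj G)\<^sup>*\<^sup>* v (p x) \<longrightarrow> (adj G)\<^sup>*\<^sup>* v (p y) \<longrightarrow> (adj H)\<^sup>*\<^sup>* x y"
        by (meson adj_rtranclp_sym rtranclp_trans)
    qed
    finally show ?thesis .
  qed
  have aux: "A \<longleftrightarrow> s \<and> t \<and> u \<and> v \<and> x \<and> y"
    if "A \<longleftrightarrow> x \<and> y" "s \<and> t \<and> u \<and> v" for A s t u v x y :: bool
    using that by blast
  define L where "L \<longleftrightarrow> (\<forall>x\<in>verts H. bij_betw (\<lambda>e. p ` e) (edges_at H x) (edges_at G (p x)))"
  define C where "C \<longleftrightarrow> (\<forall>C\<in>components G. connected_graph (preimage_subgraph p H C))"
  have "covering H G p \<longleftrightarrow> (\<lambda>e. p ` e) ` edges H = edges G \<and> L \<and> C"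
    unfolding covering_def surj_hom_def L_def C_def using sH sG surj by simp
  also have "\<dots> \<longleftrightarrow> L \<and> C" using esurj[folded L_def] by blast
  also have "L \<longleftrightarrow> (\<forall>x\<in>verts H. \<forall>b. adj G (p x) b \<longrightarrow> (\<exists>!y. adj H x y \<and> p y = b))"
    unfolding L_def by (rule ball_cong[OF refl local])
  also have "C \<longleftrightarrow> (\<forall>x\<in>verts H. \<forall>y\<in>verts H. (adj G)\<^sup>*\<^sup>* (p x) (p y) \<longrightarrow> (adj H)\<^sup>*\<^sup>* x y)"
    unfolding C_def by (rule conn)
  finally show ?thesis by (rule aux[OF _ True])
qed

lemma covering_hom: "covering H G p \<Longrightarrow> adj H x y \<Longrightarrow> adj G (p x) (p y)"
  by (simp add: covering_iff)

lemma covering_verts: "covering H G p \<Longrightarrow> x \<in> verts H \<Longrightarrow> p x \<in> verts G"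
  by (auto simp: covering_iff)

lemma covering_lift:
  "covering H G p \<Longrightarrow> x \<in> verts H \<Longrightarrow> adj G (p x) b \<Longrightarrow> \<exists>y. adj H x y \<and> p y = b"
  unfolding covering_iff by blast

lemma covering_inj:
  "covering H G p \<Longrightarrow> adj H x y \<Longrightarrow> adj H x z \<Longrightarrow> p y = p z \<Longrightarrow> y = z"
proof -
  assume a: "covering H G p" "adj H x y" "adj H x z" "p y = p z"
  then have "x \<in> verts H" "adj G (p x) (p y)"
    using adj_verts[of H x y] covering_hom[OF a(1,2)] by (auto simp: covering_def)
  then have "\<exists>!w. adj H x w \<and> p w = p y" using a(1) unfolding covering_iff by blast
  then show "y = z" using a by auto
qed

lemma covering_surj: "covering H G p \<Longrightarrow> a \<in> verts G \<Longrightarrow> \<exists>x\<in>verts H. p x = a"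
  unfolding covering_def surj_hom_def by (metis imageE)

lemma covering_conn:
  "covering H G p \<Longrightarrow> x \<in> verts H \<Longrightarrow> y \<in> verts H \<Longrightarrow> (adj G)\<^sup>*\<^sup>* (p x) (p y) \<Longrightarrow> (adj H)\<^sup>*\<^sup>* x y"
  unfolding covering_iff by blast

lemma covering_pow: "covering H G p \<Longrightarrow> (adj H ^^ n) x y \<Longrightarrow> (adj G ^^ n) (p x) (p y)"
  by (induction n arbitrary: y) (auto dest: covering_hom)

lemma covering_rtranclp: "covering H G p \<Longrightarrow> (adj H)\<^sup>*\<^sup>* x y \<Longrightarrow> (adj G)\<^sup>*\<^sup>* (p x) (p y)"
  by (metis covering_pow relpowp_imp_rtranclp rtranclp_imp_relpowp)

lemma covering_lift_pow:
  assumes "covering H G p" "x \<in> verts H"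
  shows "(adj G ^^ n) (p x) b \<Longrightarrow> \<exists>y. (adj H ^^ n) x y \<and> p y = b"
proof (induction n arbitrary: b)
  case (Suc n)
  then obtain c where c: "(adj G ^^ n) (p x) c" "adj G c b" by auto
  then obtain y where y: "(adj H ^^ n) x y" "p y = c" using Suc.IH by blast
  then have "y \<in> verts H" using adj_pow_verts assms by (metis covering_def)
  then obtain z where "adj H y z" "p z = b" using covering_lift[OF assms(1)] c(2) y(2) by blast
  then show ?case using y by auto
qed simp

lemma covering_factor:
  assumes P: "covering P G pr" and H: "covering H G p"
    and qv: "\<And>x. x \<in> verts P \<Longrightarrow> q x \<in> verts H"
    and qe: "\<And>x y. adj P x y \<Longrightarrow> adj H (q x) (q y)"
    and eq: "\<And>x. x \<in> verts P \<Longrightarrow> pr x = p (q x)"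
  shows "covering P H q"
proof -
  have sP: "simple_graph P" and sH: "simple_graph H" using P H by (auto simp: covering_def)
  have lift: "\<exists>y. adj P x y \<and> q y = b" if x: "x \<in> verts P" and b: "adj H (q x) b" for x b
  proof -
    have "adj G (pr x) (p b)" using covering_hom[OF H b] eq[OF x] by simp
    then obtain y where y: "adj P x y" "pr y = p b" using covering_lift[OF P x] by blast
    then have "y \<in> verts P" using adj_verts[OF sP] by blast
    then have "q y = b" using covering_inj[OF H qe[OF y(1)] b] eq y(2) by simp
    then show ?thesis using y by blast
  qed
  have surj: "b \<in> q ` verts P" if b: "b \<in> verts H" for b
  proof -
    obtain x where x: "x \<in> verts P" "pr x = p b"
      using covering_surj[OF P covering_verts[OF H b]] by blast
    then have "(adj H)\<^sup>*\<^sup>* (q x) b" using covering_conn[OF H qv[OF x(1)] b] eq[OF x(1)] by simp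
    then show ?thesis
    proof (induction rule: rtranclp_induct)
      case (step y z)
      then obtain x' where "x' \<in> verts P" "q x' = y" by blast
      then show ?case using lift[of x' z] step(2) adj_verts[OF sP] by blast
    qed (use x in blast)
  qed
  show ?thesis unfolding covering_iff
  proof (intro conjI ballI allI impI)
    show "q ` verts P = verts H" using surj qv by blast
    fix x assume x: "x \<in> verts P"
    show "\<exists>!y. adj P x y \<and> q y = b" if b: "adj H (q x) b" for b
    proof (rule ex_ex1I)
      fix y z assume "adj P x y \<and> q y = b" "adj P x z \<and> q z = b"
      then show "y = z" using covering_inj[OF P, of x y z] eq adj_verts[OF sP] by metis
    qed (rule lift[OF x b])
    show "(adj P)\<^sup>*\<^sup>* x y" if "y \<in> verts P" "(adj H)\<^sup>*\<^sup>* (q x) (q y)" for y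
      using covering_rtranclp[OF H that(2)] eq[OF x] eq[OF that(1)] covering_conn[OF P x that(1)]
      by simp
  qed (use sP sH qe in auto)
qed

lemma ball_half_edge:
  assumes "x \<noteq> y"
  shows "{x, y} \<in> edges (ball_half G v r) \<longleftrightarrow> adj G x y \<and> gdist G v x + gdist G v y < enat r"
  using assms by (auto simp: ball_half_def adj_def)

lemma ball_halfE:
  assumes "x \<in> verts (ball_half G v r)"
  obtains n where "gdist G v x = enat n" "2 * n \<le> r" "x \<in> verts G" "(adj G ^^ n) v x"
proof -
  have *: "2 * gdist G v x \<le> enat r" "x \<in> verts G" using assms by (auto simp: ball_half_def)
  obtain n where n: "gdist G v x = enat n"
  proof (cases "gdist G v x")
    case infinity
    then show thesis using *(1) by (simp add: numeral_eq_enat)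
  qed
  then have "2 * n \<le> r" using *(1) by (simp add: numeral_eq_enat)
  then show thesis using that n gdist_pow[OF n] * by blast
qed

lemma ball_halfI:
  assumes "simple_graph G" "v \<in> verts G" "(adj G ^^ n) v x" "2 * n \<le> r"
  shows "x \<in> verts (ball_half G v r)"
proof -
  have "2 * gdist G v x \<le> 2 * enat n" using gdist_le[OF assms(1-3)] by (rule mult_left_mono) simp
  also have "\<dots> \<le> enat r" using assms(4) by (simp add: numeral_eq_enat)
  finally show ?thesis using adj_pow_verts[OF assms(1-3)] by (simp add: ball_half_def)
qed

lemma covering_ball:
  assumes "covering H G p" "v \<in> verts H" "x \<in> verts (ball_half H v r)"
  shows "p x \<in> verts (ball_half G (p v) r)"
  using assms covering_pow[OF assms(1)] covering_verts[OF assms(1,2)]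
  by (metis ball_halfE ball_halfI covering_def)

lemma ball_preservingI:
  assumes cov: "covering H G p"
    and inj: "\<And>v x y. v \<in> verts H \<Longrightarrow> x \<in> verts (ball_half H v r) \<Longrightarrow> y \<in> verts (ball_half H v r) \<Longrightarrow>
       p x = p y \<Longrightarrow> x = y"
    and edge: "\<And>v x y. v \<in> verts H \<Longrightarrow> x \<in> verts (ball_half H v r) \<Longrightarrow> y \<in> verts (ball_half H v r) \<Longrightarrow>
       {p x, p y} \<in> edges (ball_half G (p v) r) \<Longrightarrow> adj H x y"
  shows "ball_preserving r H G p"
  unfolding ball_preserving_def graph_iso_def
proof (intro ballI conjI)
  fix v assume v: "v \<in> verts H"
  have sH: "simple_graph H" and sG: "simple_graph G" using cov by (auto simp: covering_def)
  show "bij_betw p (verts (ball_half H v r)) (verts (ball_half G (p v) r))" unfolding bij_betw_def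
  proof (intro conjI inj_onI equalityI subsetI)
    fix b assume "b \<in> verts (ball_half G (p v) r)"
    then obtain n where n: "(adj G ^^ n) (p v) b" "2 * n \<le> r" by (rule ball_halfE)
    then obtain y where "(adj H ^^ n) v y" "p y = b" using covering_lift_pow[OF cov v] by blast
    then show "b \<in> p ` verts (ball_half H v r)" using ball_halfI[OF sH v] n(2) by blast
  qed (use inj[OF v] covering_ball[OF cov v] in auto)
  have dist: "gdist H v x = gdist G (p v) (p x)" if x: "x \<in> verts (ball_half H v r)" for x
  proof (rule antisym)
    obtain n where n: "gdist G (p v) (p x) = enat n" "(adj G ^^ n) (p v) (p x)" "2 * n \<le> r"
      using covering_ball[OF cov v x] by (rule ball_halfE)
    then obtain y where y: "(adj H ^^ n) v y" "p y = p x" using covering_lift_pow[OF cov v] by blast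
    then have "y = x" using inj[OF v ball_halfI[OF sH v y(1) n(3)] x] by simp
    then show "gdist H v x \<le> gdist G (p v) (p x)" using n gdist_le[OF sH v] y(1) by simp
    obtain m where "gdist H v x = enat m" "(adj H ^^ m) v x" using x by (rule ball_halfE)
    then show "gdist G (p v) (p x) \<le> gdist H v x"
      using gdist_le[OF sG covering_verts[OF cov v]] covering_pow[OF cov] by metis
  qed
  fix x y assume x: "x \<in> verts (ball_half H v r)" and y: "y \<in> verts (ball_half H v r)"
  have no_loop: "{a} \<notin> edges (ball_half K w r)" if "simple_graph K" for K :: "'c graph" and a w
    using that by (auto simp: ball_half_def simple_graph_def)
  show "{x, y} \<in> edges (ball_half H v r) \<longleftrightarrow> {p x, p y} \<in> edges (ball_half G (p v) r)"
  proof (cases "x = y")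
    case True
    then show ?thesis using sH sG by (auto simp: ball_half_def simple_graph_def)
  next
    case False
    then have "p x \<noteq> p y" using inj[OF v x y] by blast
    then show ?thesis using False edge[OF v x y] covering_hom[OF cov] dist x y
      by (metis ball_half_edge)
  qed
qed

lemma ball_preservingD:
  assumes "ball_preserving r H G p" "v \<in> verts H"
    and "x \<in> verts (ball_half H v r)" "y \<in> verts (ball_half H v r)"
  shows "p x = p y \<Longrightarrow> x = y" "{p x, p y} \<in> edges (ball_half G (p v) r) \<Longrightarrow> adj H x y"
proof -
  have *: "graph_iso (ball_half H v r) (ball_half G (p v) r) p"
    using assms by (auto simp: ball_preserving_def)
  show "p x = p y \<Longrightarrow> x = y" using * assms unfolding graph_iso_def by (meson bij_betw_def inj_onD)
  assume "{p x, p y} \<in> edges (ball_half G (p v) r)"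
  then have "{x, y} \<in> edges (ball_half H v r)" using * assms unfolding graph_iso_def by blast
  then show "adj H x y" by (simp add: ball_half_def adj_def)
qed

lemma walk_lift_unique:
  assumes "covering H G p"
  shows "walk H xs \<Longrightarrow> walk H ys \<Longrightarrow> hd xs = hd ys \<Longrightarrow> map p xs = map p ys \<Longrightarrow> xs = ys"
proof (induction xs arbitrary: ys)
  case (Cons x xs)
  from Cons.prems obtain ys' where ys: "ys = x # ys'" by (cases ys) auto
  show ?case
  proof (cases xs)
    case Nil
    then show ?thesis using Cons.prems ys by simp
  next
    case (Cons a as)
    then obtain b bs where b: "ys' = b # bs" using Cons.prems(4) ys by (cases ys') auto
    then have "a = b" using Cons.prems Cons ys covering_inj[OF assms, of x a b]
      by (auto simp: walk_Cons)
    then show ?thesis using Cons.IH[of ys'] Cons.prems Cons ys b by (auto simp: walk_Cons)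
  qed
qed (simp add: walk_def)

text \<open>Every covering of \<open>G\<close> can be relabelled by walks in \<open>G\<close>.\<close>

lemma covering_label:
  fixes H :: "'b graph" and G :: "'a graph"
  assumes cov: "covering H G p"
  obtains f :: "'b \<Rightarrow> 'a list" where "inj_on f (verts H)"
proof -
  have sH: "simple_graph H" using cov by (auto simp: covering_def)
  define root where "root a = (SOME z. z \<in> verts H \<and> (adj G)\<^sup>*\<^sup>* (p z) a)" for a
  have root: "root (p x) \<in> verts H \<and> (adj G)\<^sup>*\<^sup>* (p (root (p x))) (p x)" if "x \<in> verts H" for x
    unfolding root_def by (rule someI[of _ x]) (use that in auto)
  have root_eq: "root a = root b" if "(adj G)\<^sup>*\<^sup>* a b" for a b
  proof -
    have "(adj G)\<^sup>*\<^sup>* z a \<longleftrightarrow> (adj G)\<^sup>*\<^sup>* z b" for z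
      using that adj_rtranclp_sym by (meson rtranclp_trans)
    then show ?thesis by (simp add: root_def)
  qed
  define w where "w x = (SOME vs. walk_betw H (root (p x)) vs x)" for x
  have w: "walk_betw H (root (p x)) (w x) x" if x: "x \<in> verts H" for x
  proof -
    have "(adj H)\<^sup>*\<^sup>* (root (p x)) x" using root[OF x] x cov by (auto simp: covering_iff)
    then have "\<exists>vs. walk_betw H (root (p x)) vs x" using root[OF x] walk_betw_iff[OF sH] by blast
    then show ?thesis unfolding w_def by (rule someI_ex)
  qed
  have "inj_on (\<lambda>x. map p (w x)) (verts H)"
  proof (rule inj_onI)
    fix x y assume x: "x \<in> verts H" and y: "y \<in> verts H" and eq: "map p (w x) = map p (w y)"
    have ne: "w x \<noteq> []" "w y \<noteq> []" using w[OF x] w[OF y] by (auto simp: walk_betw_def walk_def)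
    then have "p (last (w x)) = p (last (w y))" using eq by (metis last_map)
    then have "p x = p y" using w[OF x] w[OF y] by (simp add: walk_betw_def)
    then have "hd (w x) = hd (w y)" using w[OF x] w[OF y] by (simp add: walk_betw_def)
    then have "w x = w y"
      using walk_lift_unique[OF cov] eq w[OF x] w[OF y] by (auto simp: walk_betw_def)
    then show "x = y" using w[OF x] w[OF y] by (auto simp: walk_betw_def)
  qed
  then show thesis by (rule that)
qed

lemma relabel:
  fixes H :: "'b graph" and G :: "'a graph"
  assumes cov: "covering H G p" and bp: "ball_preserving r H G p"
  obtains H' :: "'a list graph" and g where "covering H' G (p \<circ> g)" "ball_preserving r H' G (p \<circ> g)"
    "covering H' H g"
proof -
  obtain f :: "'b \<Rightarrow> 'a list" where inj: "inj_on f (verts H)" using covering_label[OF cov] .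
  define H' where "H' = Graph (f ` verts H) ((\<lambda>e. f ` e) ` edges H)"
  define g where "g = inv_into (verts H) f"
  have sH: "simple_graph H" and sG: "simple_graph G" using cov by (auto simp: covering_def)
  have gf: "g (f x) = x" if "x \<in> verts H" for x using that inj by (simp add: g_def)
  have sH': "simple_graph H'"
    using sH inj by (auto simp: simple_graph_def H'_def card_image inj_on_subset)
  have adj': "adj H' x y \<longleftrightarrow> (\<exists>a b. x = f a \<and> y = f b \<and> adj H a b)" for x y
  proof
    assume "adj H' x y"
    then obtain e where e: "e \<in> edges H" "{x, y} = f ` e" by (auto simp: adj_def H'_def)
    then obtain a where a: "a \<in> e" "x = f a" by blast
    then obtain b where b: "e = {a, b}" "adj H a b" using edge_obtain[OF sH e(1)] by blast
    then have "y = f b" using e(2) a by (auto simp: doubleton_eq_iff)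
    then show "\<exists>a b. x = f a \<and> y = f b \<and> adj H a b" using a b by blast
  next
    assume "\<exists>a b. x = f a \<and> y = f b \<and> adj H a b"
    then obtain a b where ab: "x = f a" "y = f b" "{a, b} \<in> edges H" by (auto simp: adj_def)
    then have "{x, y} = f ` {a, b}" by simp
    then show "adj H' x y" using ab(3) unfolding adj_def H'_def graph.sel by blast
  qed
  have hom: "adj H (g x) (g y)" if "adj H' x y" for x y
    using that adj' gf adj_verts[OF sH] by metis
  have fadj: "adj H' (f a) (f b)" if "adj H a b" for a b using that adj' by blast
  have gv: "g x \<in> verts H" "f (g x) = x" if "x \<in> verts H'" for x using that gf by (auto simp: H'_def)
  have fv: "f a \<in> verts H'" if "a \<in> verts H" for a using that by (auto simp: H'_def)
  have reach: "(adj H')\<^sup>*\<^sup>* (f a) (f b)" if "(adj H)\<^sup>*\<^sup>* a b" for a b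
    using that by (induction rule: rtranclp_induct) (auto intro: rtranclp.rtrancl_into_rtrancl fadj)
  have c1: "covering H' G (p \<circ> g)" unfolding covering_iff
  proof (intro conjI ballI allI impI)
    have "g ` verts H' = verts H" using gf by (auto simp: H'_def image_image)
    then show "(p \<circ> g) ` verts H' = verts G" using cov by (metis covering_iff image_comp)
    show "adj G ((p \<circ> g) x) ((p \<circ> g) y)" if "adj H' x y" for x y
      using hom[OF that] covering_hom[OF cov] by simp
    fix x assume x: "x \<in> verts H'"
    show "\<exists>!y. adj H' x y \<and> (p \<circ> g) y = b" if b: "adj G ((p \<circ> g) x) b" for b
    proof (rule ex_ex1I)
      obtain y where y: "adj H (g x) y" "p y = b"
        using covering_lift[OF cov gv(1)[OF x]] b by auto
      then have "adj H' x (f y)" using fadj[OF y(1)] gv[OF x] by simp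
      moreover have "g (f y) = y" using gf adj_verts[OF sH y(1)] by blast
      ultimately show "\<exists>y. adj H' x y \<and> (p \<circ> g) y = b" using y by auto
      fix y z assume *: "adj H' x y \<and> (p \<circ> g) y = b" "adj H' x z \<and> (p \<circ> g) z = b"
      then have "g y = g z" using covering_inj[OF cov, of "g x" "g y" "g z"] hom by auto
      then show "y = z" using gv(2) * adj_verts[OF sH'] by metis
    qed
    show "(adj H')\<^sup>*\<^sup>* x y" if y: "y \<in> verts H'" and *: "(adj G)\<^sup>*\<^sup>* ((p \<circ> g) x) ((p \<circ> g) y)" for y
    proof -
      have "(adj H)\<^sup>*\<^sup>* (g x) (g y)" using cov * gv x y by (auto simp: covering_iff)
      then show ?thesis using reach[of "g x" "g y"] gv x y by simp
    qed
  qed (fact sH' sG)+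
  have c2: "covering H' H g" by (rule covering_factor[OF c1 cov]) (auto intro: hom gv)
  have "ball_preserving r H' G (p \<circ> g)"
  proof (rule ball_preservingI[OF c1])
    fix v x y assume v: "v \<in> verts H'" and x: "x \<in> verts (ball_half H' v r)"
      and y: "y \<in> verts (ball_half H' v r)"
    have xy: "x \<in> verts H'" "y \<in> verts H'" using x y by (auto simp: ball_half_def)
    note D = ball_preservingD[OF bp gv(1)[OF v] covering_ball[OF c2 v x] covering_ball[OF c2 v y]]
    show "x = y" if "(p \<circ> g) x = (p \<circ> g) y" using D(1) that gv(2) xy by (metis comp_apply)
    show "adj H' x y" if "{(p \<circ> g) x, (p \<circ> g) y} \<in> edges (ball_half G ((p \<circ> g) v) r)"
      using fadj[OF D(2)] that gv(2) xy by simp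
  qed
  then show thesis using that c1 c2 by blast
qed

theorem local_covering_universal:
  fixes H :: "'c graph"
  assumes loc: "local_covering r Gr G pr"
    and cov: "covering H G p" and bp: "ball_preserving r H G p"
  shows "\<exists>q. covering Gr H q \<and> (\<forall>x\<in>verts Gr. pr x = p (q x))"
proof -
  obtain H' :: "'b list graph" and g where H': "covering H' G (p \<circ> g)"
    "ball_preserving r H' G (p \<circ> g)" "covering H' H g" using relabel[OF cov bp] .
  then obtain q where q: "covering Gr H' q" "\<forall>x\<in>verts Gr. pr x = (p \<circ> g) (q x)"
    using loc unfolding local_covering_def by blast
  have "covering Gr H (g \<circ> q)"
  proof (rule covering_factor[OF _ cov])
    show "covering Gr G pr" using loc by (simp add: local_covering_def)
    show "(g \<circ> q) x \<in> verts H" if "x \<in> verts Gr" for x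
      using covering_verts[OF H'(3) covering_verts[OF q(1) that]] by simp
    show "adj H ((g \<circ> q) x) ((g \<circ> q) y)" if "adj Gr x y" for x y
      using covering_hom[OF H'(3) covering_hom[OF q(1) that]] by simp
    show "pr x = p ((g \<circ> q) x)" if "x \<in> verts Gr" for x
      using q(2) that by simp
  qed
  then show ?thesis using q(2) by (intro exI[of _ "g \<circ> q"]) auto
qed

text \<open>Existence: the fibre product of all ball-preserving coverings, restricted to one component
  over each component of \<open>G\<close>.\<close>

theorem local_covering_exists:
  fixes G :: "'a graph"
  assumes sG: "simple_graph G"
  shows "\<exists>(Gr :: 'a list graph) pr. local_covering r Gr G pr"
proof -
  define I where "I = {(H :: 'a list graph, p). covering H G p \<and> ball_preserving r H G p}"
  have I: "covering (fst i) G (snd i)" "ball_preserving r (fst i) G (snd i)" if "i \<in> I" for i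
    using that by (auto simp: I_def)
  define W where "W = {x. fst x \<in> verts G \<and>
     (\<forall>i\<in>I. snd x i \<in> verts (fst i) \<and> snd i (snd x i) = fst x) \<and>
     (\<forall>i\<in>-I. snd x i = undefined)}"
  define A where "A x y \<longleftrightarrow> x \<in> W \<and> y \<in> W \<and> adj G (fst x) (fst y) \<and>
     (\<forall>i\<in>I. adj (fst i) (snd x i) (snd y i))" for x y
  have A_sym: "A x y \<Longrightarrow> A y x" for x y by (auto simp: A_def intro: adj_sym)
  have W: "snd x i \<in> verts (fst i)" "snd i (snd x i) = fst x" if "x \<in> W" "i \<in> I" for x i
    using that unfolding W_def by blast+
  have W_fst: "fst x \<in> verts G" if "x \<in> W" for x using that unfolding W_def by blast
  have W_eq: "x = y" if "x \<in> W" "y \<in> W" "fst x = fst y" "\<And>i. i \<in> I \<Longrightarrow> snd x i = snd y i" for x y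
  proof (rule prod_eqI[OF that(3)], rule ext)
    fix i show "snd x i = snd y i"
      using that unfolding W_def by (cases "i \<in> I") simp_all
  qed
  have W_ex: "\<exists>x\<in>W. fst x = a" if a: "a \<in> verts G" for a
  proof -
    have "\<exists>z. z \<in> verts (fst i) \<and> snd i z = a" if "i \<in> I" for i
      using covering_surj[OF I(1)[OF that] a] by blast
    then obtain f where "\<And>i. i \<in> I \<Longrightarrow> f i \<in> verts (fst i) \<and> snd i (f i) = a" by metis
    then have "(a, \<lambda>i. if i \<in> I then f i else undefined) \<in> W" using a unfolding W_def by simp
    then show ?thesis by force
  qed
  have A_lift: "\<exists>y. A x y \<and> fst y = b" if x: "x \<in> W" and b: "adj G (fst x) b" for x b
  proof -
    have "\<exists>z. adj (fst i) (snd x i) z \<and> snd i z = b" if "i \<in> I" for i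
      using covering_lift[OF I(1)[OF that] W(1)[OF x that]] W(2)[OF x that] b by simp
    then obtain f where f: "\<And>i. i \<in> I \<Longrightarrow> adj (fst i) (snd x i) (f i) \<and> snd i (f i) = b" by metis
    let ?y = "(b, \<lambda>i. if i \<in> I then f i else undefined)"
    have "f i \<in> verts (fst i)" if "i \<in> I" for i
      using f[OF that] I(1)[OF that] adj_verts by (metis covering_def)
    then have "?y \<in> W" using f adj_verts[OF sG b] unfolding W_def by simp
    then have "A x ?y" using x b f unfolding A_def by simp
    then show ?thesis by force
  qed
  have A_inj: "y = z" if "A x y" "A x z" "fst y = fst z" for x y z
  proof (rule W_eq)
    fix i assume i: "i \<in> I"
    show "snd y i = snd z i"
      by (rule covering_inj[OF I(1)[OF i], of "snd x i"]) (use that i W in \<open>auto simp: A_def\<close>)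
  qed (use that in \<open>auto simp: A_def\<close>)
  define root where "root a = (SOME x. x \<in> W \<and> (adj G)\<^sup>*\<^sup>* (fst x) a)" for a
  have root: "root a \<in> W \<and> (adj G)\<^sup>*\<^sup>* (fst (root a)) a" if "a \<in> verts G" for a
    unfolding root_def by (rule someI_ex) (use W_ex[OF that] in blast)
  have root_eq: "root a = root b" if "(adj G)\<^sup>*\<^sup>* a b" for a b
  proof -
    have "(adj G)\<^sup>*\<^sup>* z a \<longleftrightarrow> (adj G)\<^sup>*\<^sup>* z b" for z
      using that adj_rtranclp_sym by (meson rtranclp_trans)
    then show ?thesis by (simp add: root_def)
  qed
  define V where "V = {x \<in> W. A\<^sup>*\<^sup>* (root (fst x)) x}"
  define P where "P = Graph V {{x, y} | x y. x \<in> V \<and> A x y}"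
  have V_step: "y \<in> V" if "x \<in> V" "A x y" for x y
  proof -
    have "root (fst x) = root (fst y)" using root_eq that(2) by (auto simp: A_def)
    then have "A\<^sup>*\<^sup>* (root (fst y)) x" "y \<in> W" using that by (auto simp: V_def A_def)
    then show ?thesis using that(2) by (simp add: V_def rtranclp.rtrancl_into_rtrancl)
  qed
  have aP: "adj P x y \<longleftrightarrow> x \<in> V \<and> A x y" for x y
  proof
    assume "adj P x y"
    then obtain x' y' where "{x, y} = {x', y'}" "x' \<in> V" "A x' y'"
      unfolding adj_def P_def graph.sel by blast
    then show "x \<in> V \<and> A x y" using V_step A_sym by (metis doubleton_eq_iff)
  next
    assume "x \<in> V \<and> A x y"
    then show "adj P x y" unfolding adj_def P_def graph.sel by blast
  qed
  have vP: "verts P = V" by (simp add: P_def)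
  have sP: "simple_graph P" unfolding simple_graph_def
  proof
    fix e assume "e \<in> edges P"
    then obtain x y where e: "e = {x, y}" "x \<in> V" "A x y" by (auto simp: P_def)
    have "x \<noteq> y" using e(3) adj_verts[OF sG] by (auto simp: A_def)
    then show "e \<subseteq> verts P \<and> card e = 2" using e V_step vP by auto
  qed
  have V_reach: "y \<in> V \<and> (adj P)\<^sup>*\<^sup>* x y" if "A\<^sup>*\<^sup>* x y" "x \<in> V" for x y
    using that
  proof (induction rule: rtranclp_induct)
    case (step y z)
    then show ?case using V_step aP by (meson rtranclp.rtrancl_into_rtrancl)
  qed auto
  have root_V: "root a \<in> V" if "a \<in> verts G" for a
    using root[OF that] root_eq[of "fst (root a)" a] by (simp add: V_def)
  have V_surj: "\<exists>x\<in>V. fst x = b" if b: "b \<in> verts G" for b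
  proof -
    have "(adj G)\<^sup>*\<^sup>* (fst (root b)) b" using root[OF b] by blast
    then show ?thesis
    proof (induction rule: rtranclp_induct)
      case (step y z)
      then obtain x where x: "x \<in> V" "fst x = y" by blast
      then obtain x' where "A x x'" "fst x' = z" using A_lift[of x z] step(2) by (auto simp: V_def)
      then show ?case using V_step[OF x(1)] by blast
    qed (use root_V[OF b] in blast)
  qed
  have covP: "covering P G fst" unfolding covering_iff
  proof (intro conjI ballI allI impI)
    show "fst ` verts P = verts G" using V_surj W_fst by (force simp: vP V_def)
    show "adj G (fst x) (fst y)" if "adj P x y" for x y using that by (simp add: aP A_def)
    fix x assume x: "x \<in> verts P"
    show "\<exists>!y. adj P x y \<and> fst y = b" if "adj G (fst x) b" for b
      using A_lift[OF _ that] A_inj x unfolding vP aP V_def by blast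
    show "(adj P)\<^sup>*\<^sup>* x y" if y: "y \<in> verts P" and xy: "(adj G)\<^sup>*\<^sup>* (fst x) (fst y)" for y
    proof -
      let ?z = "root (fst x)"
      have z: "?z \<in> V" using root_V W_fst x by (auto simp: vP V_def)
      have "(adj P)\<^sup>*\<^sup>* ?z x" using V_reach[OF _ z] x by (auto simp: vP V_def)
      moreover have "(adj P)\<^sup>*\<^sup>* ?z y"
        using V_reach[OF _ z] y root_eq[OF xy] by (auto simp: vP V_def)
      ultimately show ?thesis by (meson adj_rtranclp_sym rtranclp_trans)
    qed
  qed (fact sP sG)+
  have proj: "covering P (fst i) (\<lambda>x. snd x i)" if i: "i \<in> I" for i
    by (rule covering_factor[OF covP I(1)[OF i]]) (use W i in \<open>auto simp: vP aP V_def A_def\<close>)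
  have bpP: "ball_preserving r P G fst"
  proof (rule ball_preservingI[OF covP])
    fix v x y assume v: "v \<in> verts P" and x: "x \<in> verts (ball_half P v r)"
      and y: "y \<in> verts (ball_half P v r)"
    have xy: "x \<in> V" "y \<in> V" using x y vP by (auto simp: ball_half_def)
    then have xyW: "x \<in> W" "y \<in> W" by (auto simp: V_def)
    have vW: "v \<in> W" using v by (auto simp: vP V_def)
    note D = ball_preservingD[OF I(2) covering_verts[OF proj v] covering_ball[OF proj v x]
        covering_ball[OF proj v y]]
    show "x = y" if "fst x = fst y"
      by (rule W_eq) (use that xyW D(1) W(2) in auto)
    show "adj P x y" if e: "{fst x, fst y} \<in> edges (ball_half G (fst v) r)"
    proof -
      have "adj G (fst x) (fst y)" using e by (simp add: ball_half_def adj_def)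
      moreover have "adj (fst i) (snd x i) (snd y i)" if i: "i \<in> I" for i
        using D(2)[OF i i i i] e W(2)[OF xyW(1) i] W(2)[OF xyW(2) i] W(2)[OF vW i] by simp
      ultimately show ?thesis using xy xyW by (simp add: aP A_def)
    qed
  qed
  obtain Gr :: "'a list graph" and g where Gr: "covering Gr G (fst \<circ> g)"
    "ball_preserving r Gr G (fst \<circ> g)" "covering Gr P g" using relabel[OF covP bpP] .
  have "local_covering r Gr G (fst \<circ> g)" unfolding local_covering_def
  proof (intro conjI allI impI Gr(1,2))
    fix H :: "'a list graph" and p
    assume Hp: "covering H G p \<and> ball_preserving r H G p"
    then have i: "(H, p) \<in> I" by (simp add: I_def)
    let ?q = "\<lambda>x. snd (g x) (H, p)"
    have eq: "(fst \<circ> g) x = p (?q x)" if "x \<in> verts Gr" for x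
      using W(2)[OF _ i, of "g x"] covering_verts[OF Gr(3) that] by (simp add: vP V_def)
    have "covering Gr H ?q"
    proof (rule covering_factor[OF Gr(1)])
      show "covering H G p" using Hp by blast
      show "?q x \<in> verts H" if "x \<in> verts Gr" for x
        using covering_verts[OF proj[OF i] covering_verts[OF Gr(3) that]] by simp
      show "adj H (?q x) (?q y)" if "adj Gr x y" for x y
        using covering_hom[OF proj[OF i] covering_hom[OF Gr(3) that]] by simp
    qed (rule eq)
    then show "\<exists>q. covering Gr H q \<and> (\<forall>x\<in>verts Gr. (fst \<circ> g) x = p (q x))" using eq by blast
  qed
  then show ?thesis by blast
qed

end

theory Submission
  imports Defs
begin

text \<open>
  The implications (3) \<open>\<Longrightarrow>\<close> (1) \<open>\<Longrightarrow>\<close> (2) \<open>\<Longrightarrow>\<close> (3) rest on two facts: a locally injective homomorphism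
  (an immersion) maps non-backtracking walks to non-backtracking walks, and a non-backtracking walk
  that repeats a vertex contains a cycle. Hence the girth of the source of an immersion is at least
  that of its target. Moreover, a walk shorter than the girth of the target is closed as soon as its
  image is, as one sees by cancelling backtracks.

  For (3) \<open>\<Longrightarrow>\<close> (1), every ball of \<open>G\<close> is isomorphic to a ball of the forest \<open>G\<^sub>r\<close>. For (1) \<open>\<Longrightarrow>\<close> (2), a
  closed walk of length at most \<open>r\<close> stays in the ball of radius \<open>r/2\<close> around its first vertex. For
  (2) \<open>\<Longrightarrow>\<close> (3), girth greater than \<open>r\<close> makes every covering of \<open>G\<close> ball-preserving, in particular the
  universal covering, which is a forest. By universality \<open>G\<^sub>r\<close> covers this forest.
\<close>

section \<open>Walks, cycles and girth\<close>

lemma not_walk_Nil [simp]: "\<not> walk G []"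
  by (simp add: walk_def)

lemma walk_append:
  assumes "xs \<noteq> []" "ys \<noteq> []"
  shows "walk G (xs @ ys) \<longleftrightarrow> walk G xs \<and> walk G ys \<and> adj G (last xs) (hd ys)"
  using assms by (auto simp: walk_def adj_def successively_append_iff)

lemma walk_iff_nth:
  "walk G vs \<longleftrightarrow> vs \<noteq> [] \<and> (\<forall>i<length vs. vs ! i \<in> verts G) \<and>
     (\<forall>i. Suc i < length vs \<longrightarrow> adj G (vs ! i) (vs ! Suc i))"
  by (auto simp: walk_def adj_def successively_conv_nth set_conv_nth)

lemma walk_relpowp_nth:
  assumes "walk G vs" "i \<le> j" "j < length vs"
  shows "(adj G ^^ (j - i)) (vs ! i) (vs ! j)"
  unfolding relpowp_fun_conv
  using assms by (intro exI[of _ "\<lambda>k. vs ! (i + k)"]) (simp add: walk_iff_nth)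

lemma adj_relpowp_sym: "(adj G ^^ n) x y \<Longrightarrow> (adj G ^^ n) y x"
proof (induction n arbitrary: y)
  case (Suc n)
  then obtain z where "(adj G ^^ n) x z" "adj G z y" by auto
  then show ?case using Suc.IH adj_sym by (metis relpowp_Suc_I2)
qed simp

lemma adj_relpowp_join:
  assumes "(adj G ^^ m) v x" "(adj G ^^ n) v y"
  shows "(adj G ^^ (m + n)) x y"
  using adj_relpowp_sym[OF assms(1)] assms(2) by (auto simp: relpowp_add)

lemma is_cycle_iff_closed_walk:
  "is_cycle G c \<longleftrightarrow> 3 \<le> length c \<and> distinct c \<and> walk G (c @ [hd c])"
  by (cases "c = []") (auto simp: is_cycle_def walk_def successively_append_iff)

lemma is_cycle_append_commute: "is_cycle G (xs @ ys) \<Longrightarrow> is_cycle G (ys @ xs)"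
  by (cases "xs = []"; cases "ys = []") (auto simp: is_cycle_def walk_append adj_def)

lemma is_cycle_neighbours:
  assumes "is_cycle G c" "x \<in> set c"
  obtains y z where "y \<in> set c" "z \<in> set c" "y \<noteq> z" "adj G x y" "adj G x z"
proof -
  obtain as bs where c: "c = as @ x # bs" using assms(2) by (auto dest: split_list)
  define ds where "ds = bs @ as"
  have cyc: "is_cycle G (x # ds)" using is_cycle_append_commute assms(1) unfolding c ds_def by fastforce
  then have ds: "2 \<le> length ds" "distinct ds" by (auto simp: is_cycle_def)
  then have "ds \<noteq> []" by auto
  moreover from ds have "hd ds \<noteq> last ds" by (cases ds) auto
  moreover have "adj G x (hd ds)" "adj G x (last ds)"
    using cyc \<open>ds \<noteq> []\<close> by (auto simp: is_cycle_def walk_Cons adj_def insert_commute)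
  moreover have "set ds \<subseteq> set c" by (auto simp: c ds_def)
  ultimately show thesis using that by (meson hd_in_set last_in_set subsetD)
qed

lemma less_girth_iff: "enat r < girth G \<longleftrightarrow> (\<forall>c. is_cycle G c \<longrightarrow> r < length c)"
  by (simp add: girth_def le_INF_iff Suc_le_eq flip: Suc_ile_eq)

lemma girth_le: "is_cycle G c \<Longrightarrow> girth G \<le> enat (length c)"
  unfolding girth_def by (rule INF_lower) simp

lemma acyclic_graph_iff_girth: "acyclic_graph G \<longleftrightarrow> girth G = \<infinity>"
  unfolding acyclic_graph_def using girth_le by (fastforce simp: girth_def top_enat_def)

section \<open>Non-backtracking walks\<close>

fun nonbacktracking :: "'a list \<Rightarrow> bool" where
  "nonbacktracking (a # b # c # xs) \<longleftrightarrow> a \<noteq> c \<and> nonbacktracking (b # c # xs)"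
| "nonbacktracking _ \<longleftrightarrow> True"

lemma nonbacktracking_tl: "nonbacktracking vs \<Longrightarrow> nonbacktracking (tl vs)"
  by (induction vs rule: nonbacktracking.induct) auto

lemma nonbacktracking_Cons:
  assumes "nonbacktracking vs" "tl vs \<noteq> [] \<Longrightarrow> hd (tl vs) \<noteq> x"
  shows "nonbacktracking (x # vs)"
  using assms by (cases "x # vs" rule: nonbacktracking.cases) auto

lemma distinct_nonbacktracking: "distinct vs \<Longrightarrow> nonbacktracking vs"
  by (induction vs rule: nonbacktracking.induct) auto

lemma is_cycle_nonbacktracking:
  assumes "is_cycle G c"
  shows "nonbacktracking (c @ [hd c])"
proof -
  have "3 \<le> length c" "distinct c" using assms by (auto simp: is_cycle_def)
  then obtain x y z zs where c: "c = x # y # z # zs" by (auto simp: Suc_le_length_iff numeral_3_eq_3)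
  then have "nonbacktracking ((y # z # zs) @ [x])"
    using \<open>distinct c\<close> by (intro distinct_nonbacktracking) auto
  then show ?thesis using \<open>distinct c\<close> c by simp
qed

lemma walk_betw_reduce_Cons:
  assumes "u \<in> verts G" "adj G u w" "walk_betw G w ws v" "nonbacktracking ws"
  shows "\<exists>us. walk_betw G u us v \<and> nonbacktracking us \<and> length us \<le> Suc (length ws)"
proof (cases "tl ws \<noteq> [] \<and> hd (tl ws) = u")
  case True
  then have "walk_betw G u (tl ws) v"
    using assms(3) by (cases ws) (auto simp: walk_betw_def walk_Cons)
  then show ?thesis using nonbacktracking_tl[OF assms(4)] by (intro exI[of _ "tl ws"]) simp
next
  case False
  then have "nonbacktracking (u # ws)" by (intro nonbacktracking_Cons assms(4)) simp
  moreover have "walk_betw G u (u # ws) v"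
    using assms(1-3) by (cases ws) (auto simp: walk_betw_def walk_Cons)
  ultimately show ?thesis by (intro exI[of _ "u # ws"]) simp
qed

lemma walk_betw_reduce:
  "walk_betw G u vs v \<Longrightarrow> \<exists>ws. walk_betw G u ws v \<and> nonbacktracking ws \<and> length ws \<le> length vs"
proof (induction vs arbitrary: u)
  case (Cons x xs)
  then have x: "x = u" "u \<in> verts G" by (auto simp: walk_betw_def walk_Cons)
  show ?case
  proof (cases "xs = []")
    case True
    then show ?thesis using Cons.prems by (intro exI[of _ "[x]"]) auto
  next
    case False
    then have "walk_betw G (hd xs) xs v" and adj: "adj G u (hd xs)"
      using Cons.prems x by (auto simp: walk_betw_def walk_Cons)
    then obtain ws where "walk_betw G (hd xs) ws v" "nonbacktracking ws" "length ws \<le> length xs"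
      using Cons.IH by blast
    then show ?thesis using walk_betw_reduce_Cons[OF x(2) adj] by fastforce
  qed
qed (simp add: walk_betw_def)

lemma girth_le_nonbacktracking:
  assumes "simple_graph G"
  shows "walk G vs \<Longrightarrow> nonbacktracking vs \<Longrightarrow> \<not> distinct vs \<Longrightarrow> girth G \<le> enat (length vs - 1)"
proof (induction vs)
  case (Cons x xs)
  show ?case
  proof (cases "distinct xs")
    case False
    have "nonbacktracking xs" "walk G xs"
      using nonbacktracking_tl[OF Cons.prems(2)] Cons.prems False by (auto simp: walk_Cons)
    then have "girth G \<le> enat (length xs - 1)" using Cons.IH False by blast
    then show ?thesis by (rule order_trans) simp
  next
    case True
    then obtain as bs where xs: "xs = as @ x # bs" using Cons.prems(3) by (auto dest: split_list)
    have "walk G ((x # as) @ x # bs)" using Cons.prems(1) xs by simp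
    then have walk: "walk G (x # as)" and close: "adj G (last (x # as)) x"
      using walk_append[of "x # as" "x # bs" G] by auto
    have "as \<noteq> []" using close adj_verts[OF assms] by fastforce
    moreover have "as \<noteq> [a]" for a using Cons.prems(2) xs by auto
    ultimately have "2 \<le> length as" by (cases as; cases "tl as") auto
    then have "is_cycle G (x # as)" using walk close True xs by (auto simp: is_cycle_def adj_def)
    from girth_le[OF this] show ?thesis by (rule order_trans) (simp add: xs)
  qed
qed simp

section \<open>Immersions\<close>

definition graph_immersion :: "'b graph \<Rightarrow> 'a graph \<Rightarrow> ('b \<Rightarrow> 'a) \<Rightarrow> bool" where
  "graph_immersion H G p \<longleftrightarrow> p ` verts H \<subseteq> verts G \<and>
     (\<forall>x\<in>verts H. \<forall>y\<in>verts H. adj H x y \<longrightarrow> adj G (p x) (p y)) \<and>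
     (\<forall>x\<in>verts H. inj_on p {y \<in> verts H. adj H x y})"

lemma graph_immersion_subgraph:
  assumes "verts H \<subseteq> verts G" "edges H \<subseteq> edges G"
  shows "graph_immersion H G (\<lambda>x. x)"
  using assms by (auto simp: graph_immersion_def adj_def)

lemma graph_immersionD:
  assumes "graph_immersion H G p" "x \<in> verts H"
  shows "p x \<in> verts G"
    and "y \<in> verts H \<Longrightarrow> adj H x y \<Longrightarrow> adj G (p x) (p y)"
    and "inj_on p {y \<in> verts H. adj H x y}"
  using assms by (auto simp: graph_immersion_def)

lemma graph_immersion_comp:
  assumes q: "graph_immersion K H q" and p: "graph_immersion H G p"
  shows "graph_immersion K G (p \<circ> q)"
  unfolding graph_immersion_def
proof (intro conjI ballI impI comp_inj_on)
  show "(p \<circ> q) ` verts K \<subseteq> verts G"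
    using graph_immersionD(1)[OF q] graph_immersionD(1)[OF p] by auto
  fix x assume x: "x \<in> verts K"
  note qx = graph_immersionD[OF q x]
  show "adj G ((p \<circ> q) x) ((p \<circ> q) y)" if "y \<in> verts K" "adj K x y" for y
    using graph_immersionD(2)[OF p qx(1)] graph_immersionD(1)[OF q] qx(2) that by simp
  show "inj_on q {y \<in> verts K. adj K x y}" by (rule qx(3))
  show "inj_on p (q ` {y \<in> verts K. adj K x y})"
    using graph_immersionD(3)[OF p qx(1)]
    by (rule inj_on_subset) (use graph_immersionD(1)[OF q] qx(2) in auto)
qed

lemma graph_iso_immersion_inv:
  assumes "graph_iso G H f"
  shows "graph_immersion H G (inv_into (verts G) f)"
proof -
  have bij: "bij_betw f (verts G) (verts H)" using assms by (simp add: graph_iso_def)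
  then have inv: "bij_betw (inv_into (verts G) f) (verts H) (verts G)" by (rule bij_betw_inv_into)
  then show ?thesis
    using assms bij_betw_inv_into_right[OF bij] bij_betwE[OF inv] bij_betw_imp_inj_on[OF inv]
    by (auto simp: graph_immersion_def graph_iso_def adj_def intro: inj_on_subset)
qed

lemma covering_immersion: "covering H G p \<Longrightarrow> graph_immersion H G p"
  using covering_verts covering_hom covering_inj by (fastforce simp: graph_immersion_def inj_on_def)

lemma walk_immersion:
  assumes "graph_immersion H G p" "walk H vs"
  shows "walk G (map p vs)"
  using assms(2) by (simp add: walk_iff_nth graph_immersionD[OF assms(1)])

lemma nonbacktracking_immersion:
  assumes "graph_immersion H G p"
  shows "walk H vs \<Longrightarrow> nonbacktracking vs \<Longrightarrow> nonbacktracking (map p vs)"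
proof (induction vs rule: nonbacktracking.induct)
  case (1 a b c xs)
  then have "b \<in> verts H" "a \<in> verts H" "c \<in> verts H" "adj H b a" "adj H b c" "a \<noteq> c"
    by (auto simp: walk_Cons intro: adj_sym)
  then have "p a \<noteq> p c" using graph_immersionD(3)[OF assms, of b] by (auto dest: inj_onD)
  then show ?case using 1 by (simp add: walk_Cons)
qed auto

theorem girth_immersion:
  assumes imm: "graph_immersion H G p" and "simple_graph G"
  shows "girth G \<le> girth H"
  unfolding girth_def[of H]
proof (rule INF_greatest)
  fix c assume "c \<in> {c. is_cycle H c}"
  then have c: "is_cycle H c" by simp
  then have "c \<noteq> []" and walk: "walk H (c @ [hd c])" by (auto simp: is_cycle_iff_closed_walk)
  then have "\<not> distinct (map p (c @ [hd c]))" by simp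
  with walk_immersion[OF imm walk] nonbacktracking_immersion[OF imm walk is_cycle_nonbacktracking[OF c]]
  have "girth G \<le> enat (length (map p (c @ [hd c])) - 1)"
    by (rule girth_le_nonbacktracking[OF \<open>simple_graph G\<close>])
  then show "girth G \<le> enat (length c)" by simp
qed

corollary acyclic_graph_immersion:
  assumes "graph_immersion H G p" "simple_graph G" "acyclic_graph G"
  shows "acyclic_graph H"
  using girth_immersion[OF assms(1,2)] assms(3) by (simp add: acyclic_graph_iff_girth)

lemma immersion_closed_relpowp:
  assumes imm: "graph_immersion H G p" and simple: "simple_graph H" "simple_graph G"
    and x: "x \<in> verts H" and y: "(adj H ^^ n) x y" and closed: "p x = p y"
    and girth: "enat n < girth G"
  shows "x = y"
proof (rule ccontr)
  assume "x \<noteq> y"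
  obtain vs where vs: "walk_betw H x vs y" "length vs = Suc n"
    using pow_walk[OF simple(1) x y] by blast
  then obtain ws where ws: "walk_betw H x ws y" "nonbacktracking ws" "length ws \<le> Suc n"
    using walk_betw_reduce by metis
  then have walk: "walk H ws" by (simp add: walk_betw_def)
  have "\<not> distinct (map p ws)"
    using ws(1) closed \<open>x \<noteq> y\<close> by (cases ws) (auto simp: walk_betw_def split: if_splits)
  with walk_immersion[OF imm walk] nonbacktracking_immersion[OF imm walk ws(2)]
  have "girth G \<le> enat (length (map p ws) - 1)" by (rule girth_le_nonbacktracking[OF simple(2)])
  also have "\<dots> \<le> enat n" using ws(3) by simp
  finally show False using girth by simp
qed

section \<open>Short cycles and acyclic balls\<close>

lemma closed_walk_gdist_add_le:
  assumes simple: "simple_graph G" and walk: "walk G vs" and closed: "hd vs = last vs"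
    and "i < length vs" "j < length vs"
  shows "gdist G (hd vs) (vs ! i) + gdist G (hd vs) (vs ! j) \<le> enat i + enat (length vs - 1 - j)"
proof -
  have ne: "vs \<noteq> []" using walk by auto
  then have hd: "hd vs = vs ! 0" "hd vs = vs ! (length vs - 1)"
    using closed by (simp_all add: hd_conv_nth last_conv_nth)
  have start: "hd vs \<in> verts G" using walk ne by (auto simp: walk_def)
  have "(adj G ^^ i) (hd vs) (vs ! i)"
    using walk_relpowp_nth[OF walk, of 0 i] assms(4) hd(1) by simp
  moreover have "(adj G ^^ (length vs - 1 - j)) (hd vs) (vs ! j)"
    using adj_relpowp_sym[OF walk_relpowp_nth[OF walk, of j "length vs - 1"]] assms(5) hd(2) by simp
  ultimately show ?thesis by (intro add_mono gdist_le[OF simple start])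
qed

lemma short_closed_walk_in_ball_half:
  assumes simple: "simple_graph G" and walk: "walk G vs"
    and closed: "hd vs = last vs" and short: "length vs \<le> Suc r"
  shows "walk (ball_half G (hd vs) r) vs"
  unfolding walk_iff_nth
proof (intro conjI allI impI)
  note gdist = closed_walk_gdist_add_le[OF simple walk closed]
  show "vs \<noteq> []" using walk by auto
  fix i
  show "vs ! i \<in> verts (ball_half G (hd vs) r)" if i: "i < length vs"
  proof -
    have "2 * gdist G (hd vs) (vs ! i) \<le> enat i + enat (length vs - 1 - i)"
      using gdist[OF i i] by (simp add: mult_2)
    also have "\<dots> \<le> enat r" using i short by simp
    finally show ?thesis using walk i by (simp add: walk_iff_nth ball_half_def)
  qed
  show "adj (ball_half G (hd vs) r) (vs ! i) (vs ! Suc i)" if i: "Suc i < length vs"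
  proof -
    have adj: "adj G (vs ! i) (vs ! Suc i)" using walk i by (simp add: walk_iff_nth)
    have "gdist G (hd vs) (vs ! i) + gdist G (hd vs) (vs ! Suc i)
        \<le> enat i + enat (length vs - 1 - Suc i)"
      using gdist[OF Suc_lessD[OF i] i] .
    also have "\<dots> < enat r" using i short by simp
    finally show ?thesis using adj adj_verts[OF simple adj] by (simp add: ball_half_edge adj_def)
  qed
qed

lemma short_cycle_in_ball_half:
  assumes "simple_graph G" "is_cycle G c" "length c \<le> r"
  shows "is_cycle (ball_half G (hd c) r) c"
proof -
  have "c \<noteq> []" using assms(2) by (auto simp: is_cycle_def)
  then show ?thesis
    using assms short_closed_walk_in_ball_half[OF assms(1), of "c @ [hd c]" r]
    by (simp add: is_cycle_iff_closed_walk)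
qed

lemma locally_acyclic_imp_less_girth:
  assumes "simple_graph G" "locally_acyclic r G"
  shows "enat r < girth G"
  unfolding less_girth_iff
proof (intro allI impI, rule ccontr)
  fix c assume c: "is_cycle G c" and "\<not> r < length c"
  then have "is_cycle (ball_half G (hd c) r) c" using short_cycle_in_ball_half[OF assms(1)] by simp
  moreover have "hd c \<in> verts G" using c by (auto simp: is_cycle_def walk_def)
  ultimately show False using assms(2) by (auto simp: locally_acyclic_def acyclic_graph_def)
qed

section \<open>Ball-preserving coverings\<close>

lemma acyclic_ball_preserving_imp_locally_acyclic:
  assumes cov: "covering H G p" and bp: "ball_preserving r H G p" and "acyclic_graph H"
  shows "locally_acyclic r G"
  unfolding locally_acyclic_def
proof
  fix v assume "v \<in> verts G"
  then obtain x where x: "x \<in> verts H" "p x = v" using covering_surj[OF cov] by blast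
  then have "graph_iso (ball_half H x r) (ball_half G v r) p"
    using bp by (auto simp: ball_preserving_def)
  then have "graph_immersion (ball_half G v r) (ball_half H x r) (inv_into (verts (ball_half H x r)) p)"
    by (rule graph_iso_immersion_inv)
  moreover have "graph_immersion (ball_half H x r) H (\<lambda>x. x)"
    by (rule graph_immersion_subgraph) (auto simp: ball_half_def)
  ultimately show "acyclic_graph (ball_half G v r)"
    using acyclic_graph_immersion[OF graph_immersion_comp] assms by (metis covering_def)
qed

lemma covering_gdist_le:
  assumes cov: "covering H G p" and v: "v \<in> verts H"
  shows "gdist G (p v) (p x) \<le> gdist H v x"
proof (cases "gdist H v x")
  case (enat n)
  then have "(adj G ^^ n) (p v) (p x)" by (rule covering_pow[OF cov gdist_pow])
  then show ?thesis using gdist_le covering_verts[OF cov v] cov enat by (metis covering_def)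
qed simp

lemma covering_gdist_ball_half:
  assumes cov: "covering H G p" and v: "v \<in> verts H"
    and inj: "inj_on p (verts (ball_half H v r))" and x: "x \<in> verts (ball_half H v r)"
  shows "gdist G (p v) (p x) = gdist H v x"
proof (rule antisym[OF covering_gdist_le[OF cov v]])
  have simple: "simple_graph H" using cov by (simp add: covering_def)
  obtain n where n: "gdist G (p v) (p x) = enat n" "2 * n \<le> r" "(adj G ^^ n) (p v) (p x)"
    using covering_ball[OF cov v x] by (rule ball_halfE)
  then obtain z where z: "(adj H ^^ n) v z" "p z = p x" using covering_lift_pow[OF cov v] by blast
  then have "z = x" using inj_onD[OF inj] ball_halfI[OF simple v z(1) n(2)] x by blast
  then show "gdist H v x \<le> gdist G (p v) (p x)" using gdist_le[OF simple v z(1)] n(1) by simp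
qed

lemma covering_inj_on_ball_half:
  assumes cov: "covering H G p" and girth: "enat r < girth G"
  shows "inj_on p (verts (ball_half H v r))"
proof (rule inj_onI)
  have simple: "simple_graph H" "simple_graph G" using cov by (auto simp: covering_def)
  fix x y assume "x \<in> verts (ball_half H v r)" "y \<in> verts (ball_half H v r)" and p: "p x = p y"
  then obtain m n where m: "2 * m \<le> r" "x \<in> verts H" "(adj H ^^ m) v x"
    and n: "2 * n \<le> r" "(adj H ^^ n) v y" by (elim ball_halfE)
  have "enat (m + n) \<le> enat r" using m(1) n(1) by simp
  then have "enat (m + n) < girth G" using girth by (rule le_less_trans)
  with adj_relpowp_join[OF m(3) n(2)] p show "x = y"
    by (rule immersion_closed_relpowp[OF covering_immersion[OF cov] simple m(2)])
qed

theorem covering_less_girth_ball_preserving: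
  assumes cov: "covering H G p" and girth: "enat r < girth G"
  shows "ball_preserving r H G p"
proof (rule ball_preservingI[OF cov])
  have simple: "simple_graph H" "simple_graph G" using cov by (auto simp: covering_def)
  fix v x y assume v: "v \<in> verts H"
    and x: "x \<in> verts (ball_half H v r)" and y: "y \<in> verts (ball_half H v r)"
  have inj: "inj_on p (verts (ball_half H v r))" by (rule covering_inj_on_ball_half[OF cov girth])
  then show "p x = p y \<Longrightarrow> x = y" using x y by (simp add: inj_onD)
  obtain m where m: "gdist H v x = enat m" "x \<in> verts H" "(adj H ^^ m) v x"
    using x by (rule ball_halfE)
  obtain n where n: "gdist H v y = enat n" "(adj H ^^ n) v y" using y by (rule ball_halfE)
  assume edge: "{p x, p y} \<in> edges (ball_half G (p v) r)"
  then have "p x \<noteq> p y" using simple(2) by (auto simp: ball_half_def simple_graph_def)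
  then have adj: "adj G (p x) (p y)" and "gdist G (p v) (p x) + gdist G (p v) (p y) < enat r"
    using edge by (simp_all add: ball_half_edge)
  then have "enat (Suc (m + n)) \<le> enat r"
    using covering_gdist_ball_half[OF cov v inj] x y m(1) n(1) by simp
  then have short: "enat (Suc (m + n)) < girth G" using girth by (rule le_less_trans)
  obtain z where z: "adj H x z" "p z = p y" using covering_lift[OF cov m(2) adj] by blast
  have "(adj H ^^ Suc (m + n)) z y"
    using adj_sym[OF z(1)] adj_relpowp_join[OF m(3) n(2)] by (rule relpowp_Suc_I2)
  then have "z = y"
    using immersion_closed_relpowp[OF covering_immersion[OF cov] simple] short z(2)
      adj_verts[OF simple(1) z(1)] by blast
  then show "adj H x y" using z(1) by simp
qed

section \<open>The universal covering\<close>

definition component_root :: "'a graph \<Rightarrow> 'a \<Rightarrow> 'a" where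
  "component_root G a = (SOME z. (adj G)\<^sup>*\<^sup>* z a)"

text \<open>A vertex of the universal covering is a non-backtracking walk from the root of a component,
  stored in reverse, so that the covering map is \<open>hd\<close> and the parent of a vertex is its tail.\<close>

definition reduced_walks :: "'a graph \<Rightarrow> 'a list set" where
  "reduced_walks G = {vs. walk G vs \<and> nonbacktracking vs \<and> last vs = component_root G (last vs)}"

definition universal_cover :: "'a graph \<Rightarrow> 'a list graph" where
  "universal_cover G = Graph (reduced_walks G)
     {{vs, tl vs} | vs. vs \<in> reduced_walks G \<and> tl vs \<in> reduced_walks G}"

lemma component_root: "(adj G)\<^sup>*\<^sup>* (component_root G a) a"
  unfolding component_root_def by (rule someI[of _ a]) simp

lemma component_root_eq:
  assumes "(adj G)\<^sup>*\<^sup>* a b"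
  shows "component_root G a = component_root G b"
proof -
  have "(adj G)\<^sup>*\<^sup>* z a \<longleftrightarrow> (adj G)\<^sup>*\<^sup>* z b" for z
    using assms adj_rtranclp_sym by (meson rtranclp_trans)
  then show ?thesis by (simp add: component_root_def)
qed

lemma Nil_notin_reduced_walks [simp]: "[] \<notin> reduced_walks G"
  by (simp add: reduced_walks_def)

lemma reduced_walks_tl:
  assumes "vs \<in> reduced_walks G" "tl vs \<noteq> []"
  shows "tl vs \<in> reduced_walks G" "adj G (hd vs) (hd (tl vs))"
  using assms nonbacktracking_tl[of vs]
  by (cases vs; auto simp: reduced_walks_def walk_Cons)+

lemma verts_universal_cover [simp]: "verts (universal_cover G) = reduced_walks G"
  by (simp add: universal_cover_def)

lemma adj_universal_cover:
  "adj (universal_cover G) vs ws \<longleftrightarrow>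
     vs \<in> reduced_walks G \<and> ws \<in> reduced_walks G \<and> (ws = tl vs \<or> vs = tl ws)"
  unfolding adj_def universal_cover_def graph.sel mem_Collect_eq doubleton_eq_iff by blast

lemma simple_graph_universal_cover: "simple_graph (universal_cover G)"
proof -
  have "vs \<noteq> tl vs" if "vs \<in> reduced_walks G" for vs :: "'a list"
    using that by (cases vs) auto
  then show ?thesis by (auto simp: simple_graph_def universal_cover_def card_2_iff)
qed

lemma universal_cover_hom:
  assumes "adj (universal_cover G) vs ws"
  shows "adj G (hd vs) (hd ws)"
  using assms reduced_walks_tl(2) adj_sym by (fastforce simp: adj_universal_cover)

lemma universal_cover_lift:
  assumes simple: "simple_graph G" and vs: "vs \<in> reduced_walks G" and b: "adj G (hd vs) b"
  shows "\<exists>!ws. adj (universal_cover G) vs ws \<and> hd ws = b"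
proof -
  have nbr: "adj (universal_cover G) vs ws \<and> hd ws = b \<longleftrightarrow>
    ws \<in> reduced_walks G \<and> (ws = tl vs \<and> hd (tl vs) = b \<or> ws = b # vs)" for ws
    using vs by (cases vs; cases ws) (auto simp: adj_universal_cover)
  show ?thesis
  proof (cases "tl vs \<noteq> [] \<and> hd (tl vs) = b")
    case True
    then have "\<not> nonbacktracking (b # vs)" by (cases vs; cases "tl vs") auto
    then have "b # vs \<notin> reduced_walks G" by (simp add: reduced_walks_def)
    then show ?thesis unfolding nbr using True reduced_walks_tl(1)[OF vs] by blast
  next
    case False
    then have "nonbacktracking (b # vs)"
      using vs by (intro nonbacktracking_Cons) (simp_all add: reduced_walks_def)
    then have "b # vs \<in> reduced_walks G"
      using vs adj_sym[OF b] adj_verts[OF simple b]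
      by (cases "vs = []") (auto simp: reduced_walks_def walk_Cons)
    moreover have "\<not> (tl vs \<in> reduced_walks G \<and> hd (tl vs) = b)" using False by auto
    ultimately show ?thesis unfolding nbr by blast
  qed
qed

lemma universal_cover_reach_root:
  "vs \<in> reduced_walks G \<Longrightarrow> (adj (universal_cover G))\<^sup>*\<^sup>* vs [component_root G (hd vs)]"
proof (induction vs)
  case (Cons a vs)
  show ?case
  proof (cases "vs = []")
    case True
    then show ?thesis using Cons.prems by (auto simp: reduced_walks_def)
  next
    case False
    then have vs: "vs \<in> reduced_walks G" "adj G a (hd vs)"
      using reduced_walks_tl[OF Cons.prems] by auto
    then have "component_root G a = component_root G (hd vs)" by (intro component_root_eq) blast
    moreover have "adj (universal_cover G) (a # vs) vs"
      using Cons.prems vs(1) by (simp add: adj_universal_cover)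
    ultimately show ?thesis using Cons.IH[OF vs(1)] by (simp add: converse_rtranclp_into_rtranclp)
  qed
qed simp

lemma universal_cover_surj:
  assumes simple: "simple_graph G" and a: "a \<in> verts G"
  shows "\<exists>vs\<in>reduced_walks G. hd vs = a"
  using component_root[of G a]
proof (induction rule: rtranclp_induct)
  case base
  have "component_root G a \<in> verts G"
    by (rule adj_rtranclp_verts[OF simple a adj_rtranclp_sym[OF component_root]])
  then have "[component_root G a] \<in> reduced_walks G"
    using component_root_eq[OF component_root[of G a]] by (simp add: reduced_walks_def walk_def)
  then show ?case by force
next
  case (step b c)
  then obtain vs where "vs \<in> reduced_walks G" "hd vs = b" by blast
  then show ?case using universal_cover_lift[OF simple] step(2) by (metis adj_universal_cover)
qed

theorem covering_universal_cover:
  assumes simple: "simple_graph G"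
  shows "covering (universal_cover G) G hd"
  unfolding covering_iff
proof (intro conjI ballI allI impI)
  show "hd ` verts (universal_cover G) = verts G"
    using universal_cover_surj[OF simple] by (force simp: reduced_walks_def walk_def)
  show "(adj (universal_cover G))\<^sup>*\<^sup>* vs ws"
    if "vs \<in> verts (universal_cover G)" "ws \<in> verts (universal_cover G)" "(adj G)\<^sup>*\<^sup>* (hd vs) (hd ws)"
    for vs ws
    using that universal_cover_reach_root[of vs G] universal_cover_reach_root[of ws G]
      component_root_eq[OF that(3)] by (metis adj_rtranclp_sym rtranclp_trans verts_universal_cover)
qed (use simple simple_graph_universal_cover universal_cover_hom universal_cover_lift[OF simple] in auto)

text \<open>Both neighbours on a cycle of a longest vertex of the cycle would be its parent.\<close>

theorem acyclic_universal_cover: "acyclic_graph (universal_cover G)"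
  unfolding acyclic_graph_def
proof
  assume "\<exists>c. is_cycle (universal_cover G) c"
  then obtain c where c: "is_cycle (universal_cover G) c" by blast
  then have "Max (length ` set c) \<in> length ` set c" by (intro Max_in) (auto simp: is_cycle_def)
  then obtain vs where vs: "vs \<in> set c" "length vs = Max (length ` set c)" by (metis imageE)
  have longest: "length ws \<le> length vs" if "ws \<in> set c" for ws using that vs(2) by simp
  have parent: "ws = tl vs" if "ws \<in> set c" "adj (universal_cover G) vs ws" for ws
    using longest[OF that(1)] that(2) by (cases ws) (auto simp: adj_universal_cover)
  obtain ws us where "ws \<in> set c" "us \<in> set c" "ws \<noteq> us"
    "adj (universal_cover G) vs ws" "adj (universal_cover G) vs us"
    using is_cycle_neighbours[OF c vs(1)] .
  then show False using parent by blast
qed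

lemma less_girth_imp_acyclic_local_cover:
  assumes simple: "simple_graph G" and loc: "local_covering r Gr G pr" and girth: "enat r < girth G"
  shows "acyclic_graph Gr"
proof -
  note cov = covering_universal_cover[OF simple]
  have "ball_preserving r (universal_cover G) G hd"
    by (rule covering_less_girth_ball_preserving[OF cov girth])
  then obtain q where "covering Gr (universal_cover G) q"
    using local_covering_universal[OF loc cov] by blast
  then show ?thesis
    using acyclic_graph_immersion[OF covering_immersion simple_graph_universal_cover]
      acyclic_universal_cover by blast
qed

theorem theorem4p1:
  fixes G :: "'a graph" and r :: nat and Gr :: "'b graph" and pr :: "'b \<Rightarrow> 'a"
  assumes "simple_graph G"
    and "local_covering r Gr G pr"
  shows "(locally_acyclic r G \<longleftrightarrow> girth G > enat r) \<and>
         (girth G > enat r \<longleftrightarrow> acyclic_graph Gr)"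
proof -
  have "enat r < girth G" if "locally_acyclic r G"
    using assms(1) that by (rule locally_acyclic_imp_less_girth)
  moreover have "acyclic_graph Gr" if "enat r < girth G"
    using assms that by (rule less_girth_imp_acyclic_local_cover)
  moreover have "locally_acyclic r G" if "acyclic_graph Gr"
    using assms(2) acyclic_ball_preserving_imp_locally_acyclic that
    unfolding local_covering_def by blast
  ultimately show ?thesis by blast
qed

end
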